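(* Let $1<p<\infty$, let $E\subset\mathbb{R}^n$ be a bounded domain, and let $v\ge 0$ be a weight with $v\in L^p(E)$ and $\int_E v\,dx>0$; set $w=v^p$. Then there are positive constants $c_1,c_2,c_3$ depending only on $E$, $p$ and $v$ such that for all $f\in C^1(\overline{E})$, $$c_1\|f-f_{E,w}\|_{L^p(v;E)}\le\|f-f_{E,v}\|_{L^p(v;E)}\le c_2\|f-f_{E,w}\|_{L^p(v;E)}$$ and $$\|f-f_{E,v}\|_{L^p(v;E)}\le c_3\|f-f_E\|_{L^p(v;E)}.$$ Finally, if in addition $v^{-1}\in L^{p'}(E)$, where $\frac1p+\frac1{p'}=1$, then there is a constant $c_4>0$ depending only on $E$, $p$ and $v$ such that for all $f\in C^1(\overline{E})$, $$\|f-f_E\|_{L^p(v;E)}\le c_4\|f-f_{E,v}\|_{L^p(v;E)}.$$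
   Context: $\|f\|_{L^p(v;E)}=\big(\int_E|f v|^p\,dx\big)^{1/p}$ (the weight enters as a multiplier, so $\|f\|_{L^p(v;E)}^p=\int_E|f|^p w\,dx$ with $w=v^p$). For a weight $\sigma$ on $E$, $f_{E,\sigma}=\frac{1}{\sigma(E)}\int_E f\sigma\,dx$ with $\sigma(E)=\int_E\sigma\,dx$, and $f_E=\frac1{|E|}\int_E f\,dx$. $C^1(\overline E)$ denotes functions continuously differentiable up to the closure of $E$. *)

theory Defs
  imports "HOL-Analysis.Analysis"
begin

definition weight_on :: "(real ^ 'n) set \<Rightarrow> (real ^ 'n \<Rightarrow> real) \<Rightarrow> bool" where
  "weight_on E v \<longleftrightarrow>
     v \<in> borel_measurable (lebesgue_on E) \<and> (AE x in lebesgue_on E. 0 \<le> v x)"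

definition in_Lp :: "real \<Rightarrow> (real ^ 'n) set \<Rightarrow> (real ^ 'n \<Rightarrow> real) \<Rightarrow> bool" where
  "in_Lp p E g \<longleftrightarrow>
     g \<in> borel_measurable (lebesgue_on E) \<and> integrable (lebesgue_on E) (\<lambda>x. \<bar>g x\<bar> powr p)"

text \<open>The reciprocal of a weight is infinite where the weight vanishes, whereas \<open>inverse 0 = 0\<close>
  in HOL. Membership of the reciprocal in a Lebesgue space therefore requires explicitly that the
  weight vanishes only on a null set.\<close>

definition inverse_in_Lp :: "real \<Rightarrow> (real ^ 'n) set \<Rightarrow> (real ^ 'n \<Rightarrow> real) \<Rightarrow> bool" where
  "inverse_in_Lp q E v \<longleftrightarrow>
     (AE x in lebesgue_on E. v x \<noteq> 0) \<and> in_Lp q E (\<lambda>x. inverse (v x))"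

text \<open>The weight enters the norm as a multiplier. The Bochner integral is 0 for non-integrable
  functions, so this is the usual norm only if \<open>f * v\<close> is in \<open>L\<^sup>p\<close>; this is the case when
  \<open>f\<close> is bounded on \<open>E\<close> and \<open>v\<close> is in \<open>L\<^sup>p\<close>.\<close>

definition wLp_norm :: "real \<Rightarrow> (real ^ 'n \<Rightarrow> real) \<Rightarrow> (real ^ 'n) set \<Rightarrow> (real ^ 'n \<Rightarrow> real) \<Rightarrow> real" where
  "wLp_norm p v E f = (\<integral>x. \<bar>f x * v x\<bar> powr p \<partial>lebesgue_on E) powr (1 / p)"

definition weighted_mean :: "(real ^ 'n) set \<Rightarrow> (real ^ 'n \<Rightarrow> real) \<Rightarrow> (real ^ 'n \<Rightarrow> real) \<Rightarrow> real" where
  "weighted_mean E \<sigma> f =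
     (1 / (\<integral>x. \<sigma> x \<partial>lebesgue_on E)) * (\<integral>x. f x * \<sigma> x \<partial>lebesgue_on E)"

definition mean :: "(real ^ 'n) set \<Rightarrow> (real ^ 'n \<Rightarrow> real) \<Rightarrow> real" where
  "mean E f = (1 / measure lebesgue E) * (\<integral>x. f x \<partial>lebesgue_on E)"

text \<open>Functions that are continuous on the closure of \<open>E\<close> and differentiable in \<open>E\<close>, with a
  gradient \<open>G\<close> that extends continuously to the closure. Values of \<open>f\<close> outside the closure
  are irrelevant; no extension of \<open>f\<close> across the boundary is demanded.\<close>

definition C1_closure :: "(real ^ 'n) set \<Rightarrow> (real ^ 'n \<Rightarrow> real) set" where
  "C1_closure E = {f. continuous_on (closure E) f \<and>
     (\<exists>G :: real ^ 'n \<Rightarrow> real ^ 'n. continuous_on (closure E) G \<and>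
        (\<forall>x\<in>E. (f has_derivative (\<lambda>h. G x \<bullet> h)) (at x)))}"

end

theory Submission
  imports Defs
begin

text \<open>Each of the three means is a functional \<open>f \<mapsto> f\<^bsub>E,\<sigma>\<^esub>\<close> that fixes
  constants and, by Hoelder's inequality applied to \<open>\<sigma> = v h\<close> with \<open>h\<close> equal to
  \<open>v\<^bsup>p-1\<^esup>\<close>, \<open>1\<close> and \<open>v\<^bsup>-1\<^esup>\<close> respectively, is bounded on
  \<open>L\<^sup>p(v;E)\<close>. Hence \<open>|f\<^bsub>E,\<sigma>\<^esub> - c| \<le> K \<parallel>f - c\<parallel>\<close> for every
  constant \<open>c\<close>, so \<open>f\<^bsub>E,\<sigma>\<^esub>\<close> approximates \<open>f\<close>, up to a constant factor,
  as well as any other constant does.\<close>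

text \<open>Young's inequality, applied pointwise to the two factors scaled to norm 1 and then
  integrated. The unscaled form of the same bound dominates the product, which gives its
  integrability.\<close>

lemma Holder_inequality:
  fixes f g :: "'a \<Rightarrow> real"
  assumes p: "1 < p" and q: "1 < q" and pq: "1 / p + 1 / q = 1"
    and [measurable]: "f \<in> borel_measurable M" "g \<in> borel_measurable M"
    and f: "integrable M (\<lambda>x. \<bar>f x\<bar> powr p)" and g: "integrable M (\<lambda>x. \<bar>g x\<bar> powr q)"
  shows "integrable M (\<lambda>x. f x * g x)"
    and "(\<integral>x. \<bar>f x * g x\<bar> \<partial>M)
      \<le> (\<integral>x. \<bar>f x\<bar> powr p \<partial>M) powr (1 / p) * (\<integral>x. \<bar>g x\<bar> powr q \<partial>M) powr (1 / q)"
proof -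
  have young: "\<bar>f x * g x\<bar> \<le> \<bar>f x\<bar> powr p / p + \<bar>g x\<bar> powr q / q" for x
    using Youngs_inequality[OF p q pq, of "\<bar>f x\<bar>" "\<bar>g x\<bar>"] by (simp add: abs_mult)
  show int: "integrable M (\<lambda>x. f x * g x)"
    by (rule Bochner_Integration.integrable_bound[of _ "\<lambda>x. \<bar>f x\<bar> powr p / p + \<bar>g x\<bar> powr q / q"])
      (use f g young in \<open>auto intro: order_trans[OF _ abs_ge_self]\<close>)
  define X Y where "X = (\<integral>x. \<bar>f x\<bar> powr p \<partial>M)" and "Y = (\<integral>x. \<bar>g x\<bar> powr q \<partial>M)"
  have nonneg: "X \<ge> 0" "Y \<ge> 0"
    by (simp_all add: X_def Y_def)
  show "(\<integral>x. \<bar>f x * g x\<bar> \<partial>M) \<le> X powr (1 / p) * Y powr (1 / q)"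
  \<comment> \<open>A factor of norm 0 cannot be scaled to norm 1, but then it vanishes almost
    everywhere and so does the product.\<close>
  proof (cases "X = 0 \<or> Y = 0")
    case True
    then have "AE x in M. f x * g x = 0"
    proof
      assume "X = 0"
      then have "AE x in M. \<bar>f x\<bar> powr p = 0"
        using integral_nonneg_eq_0_iff_AE[OF f] by (simp add: X_def)
      then show ?thesis by eventually_elim simp
    next
      assume "Y = 0"
      then have "AE x in M. \<bar>g x\<bar> powr q = 0"
        using integral_nonneg_eq_0_iff_AE[OF g] by (simp add: Y_def)
      then show ?thesis by eventually_elim simp
    qed
    then have "(\<integral>x. \<bar>f x * g x\<bar> \<partial>M) = 0"
      by (intro integral_eq_zero_AE) auto
    then show ?thesis by simp
  next
    case False
    then have pos: "X > 0" "Y > 0" using nonneg by auto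
    \<comment> \<open>The norms of \<open>f\<close> and \<open>g\<close>. After division by them the
      right side of Young's inequality integrates to \<open>1 / p + 1 / q = 1\<close>.\<close>
    define A B where "A = X powr (1 / p)" and "B = Y powr (1 / q)"
    have AB: "A > 0" "B > 0" "A powr p = X" "B powr q = Y"
      using pos p q by (simp_all add: A_def B_def powr_powr)
    have le: "\<bar>f x * g x\<bar> / (A * B) \<le> \<bar>f x\<bar> powr p / X / p + \<bar>g x\<bar> powr q / Y / q" for x
      using Youngs_inequality[OF p q pq, of "\<bar>f x\<bar> / A" "\<bar>g x\<bar> / B"] AB
      by (simp add: abs_mult powr_divide)
    have "(\<integral>x. \<bar>f x * g x\<bar> \<partial>M) / (A * B)
        = (\<integral>x. \<bar>f x * g x\<bar> / (A * B) \<partial>M)" by simp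
    also have "\<dots> \<le> (\<integral>x. \<bar>f x\<bar> powr p / X / p + \<bar>g x\<bar> powr q / Y / q \<partial>M)"
      by (rule integral_mono) (use f g int le in \<open>auto intro!: integrable_divide integrable_abs\<close>)
    also have "\<dots> = X / X / p + Y / Y / q"
      using f g by (simp add: X_def Y_def)
    also have "\<dots> = 1" using pos pq by simp
    finally show ?thesis using AB by (simp add: A_def B_def pos_divide_le_eq)
  qed
qed

text \<open>A crude replacement for Minkowski's inequality, from |a + b| \<le> 2 max(|a|, |b|). The
  lost factor is harmless, as only the existence of constants is claimed.\<close>

lemma abs_add_powr_le:
  fixes a b p :: real
  assumes "0 \<le> p"
  shows "\<bar>a + b\<bar> powr p \<le> 2 powr p * (\<bar>a\<bar> powr p + \<bar>b\<bar> powr p)"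
proof -
  have "\<bar>a + b\<bar> powr p \<le> (2 * max \<bar>a\<bar> \<bar>b\<bar>) powr p"
    using assms by (intro powr_mono2) auto
  also have "\<dots> = 2 powr p * max \<bar>a\<bar> \<bar>b\<bar> powr p"
    by (simp add: powr_mult)
  also have "\<dots> \<le> 2 powr p * (\<bar>a\<bar> powr p + \<bar>b\<bar> powr p)"
    by (intro mult_left_mono) (auto simp: max_def)
  finally show ?thesis .
qed

text \<open>This rules out the default value 0 of the Bochner integral: for bounded measurable
  \<open>f\<close> the weighted norms below are the true ones.\<close>

lemma in_Lp_bounded_mult:
  assumes v: "in_Lp p E v" and "0 \<le> p"
    and f: "f \<in> borel_measurable (lebesgue_on E)" "bounded (f ` E)"
  shows "in_Lp p E (\<lambda>x. f x * v x)"
proof -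
  note [measurable] = f(1)
  have [measurable]: "v \<in> borel_measurable (lebesgue_on E)"
    and vi: "integrable (lebesgue_on E) (\<lambda>x. \<bar>v x\<bar> powr p)"
    using v by (auto simp: in_Lp_def)
  obtain B where B: "\<And>x. x \<in> E \<Longrightarrow> \<bar>f x\<bar> \<le> B"
    using f(2) by (auto simp: bounded_iff)
  have "integrable (lebesgue_on E) (\<lambda>x. \<bar>f x * v x\<bar> powr p)"
  proof (rule Bochner_Integration.integrable_bound)
    show "integrable (lebesgue_on E) (\<lambda>x. B powr p * \<bar>v x\<bar> powr p)"
      using vi by simp
    show "AE x in lebesgue_on E. norm (\<bar>f x * v x\<bar> powr p) \<le> norm (B powr p * \<bar>v x\<bar> powr p)"
      by (rule AE_I2) (auto simp: abs_mult powr_mult space_restrict_space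
          intro!: mult_right_mono powr_mono2 B \<open>0 \<le> p\<close>)
  qed simp
  then show ?thesis by (simp add: in_Lp_def)
qed

text \<open>\<open>C\<close> is chosen before \<open>f\<close> and \<open>c\<close>, so
  \<open>c\<close> may later be any other mean of \<open>f\<close>; every inequality of the theorem
  is such an instance. The factor \<open>h\<close> is the Hoelder partner of \<open>v\<close>, and
  one choice of \<open>h\<close> belongs to each mean.\<close>

lemma weighted_mean_near_best:
  fixes E :: "(real ^ 'n) set" and v \<sigma> h :: "real ^ 'n \<Rightarrow> real"
  assumes p: "1 < p" and q: "1 < q" and pq: "1 / p + 1 / q = 1"
    and v: "in_Lp p E v" and h: "in_Lp q E h"
    and \<sigma>: "AE x in lebesgue_on E. \<sigma> x = v x * h x" and pos: "(\<integral>x. \<sigma> x \<partial>lebesgue_on E) > 0"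
  shows "\<exists>C>0. \<forall>f c. f \<in> borel_measurable (lebesgue_on E) \<longrightarrow> bounded (f ` E) \<longrightarrow>
    wLp_norm p v E (\<lambda>x. f x - weighted_mean E \<sigma> f) \<le> C * wLp_norm p v E (\<lambda>x. f x - c)"
proof -
  define M where "M = lebesgue_on E"
  define S where "S = (\<integral>x. \<sigma> x \<partial>M)"
  define V where "V = (\<integral>x. \<bar>v x\<bar> powr p \<partial>M)"
  \<comment> \<open>\<open>K\<close> is Hoelder's bound for the functional
    \<open>weighted_mean E \<sigma>\<close> on the weighted space. \<open>C\<close> arises from
    \<open>abs_add_powr_le\<close>, with \<open>K powr p * V\<close> accounting for the constant
    function \<open>m - c\<close>.\<close>
  define K where "K = (\<integral>x. \<bar>h x\<bar> powr q \<partial>M) powr (1 / q) / S"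
  define C where "C = 2 powr p * (1 + K powr p * V)"
  have S: "S > 0" using pos by (simp add: S_def M_def)
  have [measurable]: "v \<in> borel_measurable M" "h \<in> borel_measurable M"
    and vi: "integrable M (\<lambda>x. \<bar>v x\<bar> powr p)" and hi: "integrable M (\<lambda>x. \<bar>h x\<bar> powr q)"
    using v h by (auto simp: in_Lp_def M_def)
  \<comment> \<open>A non-integrable function has Bochner integral 0, so a positive integral forces
    integrability.\<close>
  have \<sigma>i: "integrable M \<sigma>"
    using S not_integrable_integral_eq by (force simp: S_def)
  then have [measurable]: "\<sigma> \<in> borel_measurable M" by auto
  have "V \<ge> 0" "K \<ge> 0" using S by (simp_all add: V_def K_def)
  then have "C > 0" by (simp add: C_def add_pos_nonneg)
  have "wLp_norm p v E (\<lambda>x. f x - weighted_mean E \<sigma> f)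
      \<le> C powr (1 / p) * wLp_norm p v E (\<lambda>x. f x - c)"
    if f: "f \<in> borel_measurable (lebesgue_on E)" "bounded (f ` E)" for f c
  proof -
    note [measurable] = f(1)[folded M_def]
    have bdd: "bounded ((\<lambda>x. f x - b) ` E)" for b
      using bounded_translation[OF f(2), of "- b"] by (simp add: image_image)
    define u where "u = (\<lambda>x. (f x - c) * v x)"
    have [measurable]: "u \<in> borel_measurable M" by (simp add: u_def)
    have Lp: "integrable M (\<lambda>x. \<bar>(f x - b) * v x\<bar> powr p)" for b
      using in_Lp_bounded_mult[OF v _ _ bdd, of b] p f(1) by (simp add: in_Lp_def M_def)
    define X where "X = (\<integral>x. \<bar>u x\<bar> powr p \<partial>M)"
    have "X \<ge> 0" by (simp add: X_def)
    define m where "m = weighted_mean E \<sigma> f"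
    obtain B where B: "\<And>x. x \<in> E \<Longrightarrow> \<bar>f x\<bar> \<le> B"
      using f(2) by (auto simp: bounded_iff)
    have f\<sigma>: "integrable M (\<lambda>x. f x * \<sigma> x)"
    proof (rule Bochner_Integration.integrable_bound)
      show "integrable M (\<lambda>x. B * \<sigma> x)" using \<sigma>i by simp
      show "AE x in M. norm (f x * \<sigma> x) \<le> norm (B * \<sigma> x)"
        by (rule AE_I2) (auto simp: M_def abs_mult space_restrict_space
            intro!: mult_right_mono order_trans[OF B abs_ge_self])
    qed simp
    \<comment> \<open>The mean fixes constants, so \<open>m - c\<close> is the mean of
      \<open>f - c\<close>.\<close>
    have "m - c = (1 / S) * (\<integral>x. (f x - c) * \<sigma> x \<partial>M)"
      using S \<sigma>i f\<sigma> unfolding m_def weighted_mean_def M_def[symmetric] S_def[symmetric]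
      by (simp add: left_diff_distrib field_simps flip: S_def)
    also have "(\<integral>x. (f x - c) * \<sigma> x \<partial>M) = (\<integral>x. u x * h x \<partial>M)"
    proof (rule integral_cong_AE)
      show "AE x in M. (f x - c) * \<sigma> x = u x * h x"
        using \<sigma> unfolding M_def[symmetric] by eventually_elim (simp add: u_def)
    qed simp_all
    finally have "\<bar>m - c\<bar> \<le> (1 / S) * (\<integral>x. \<bar>u x * h x\<bar> \<partial>M)"
      using S integral_abs_bound[of M "\<lambda>x. u x * h x"] by (simp add: abs_mult divide_right_mono)
    also have "\<dots> \<le> (1 / S) * (X powr (1 / p) * (\<integral>x. \<bar>h x\<bar> powr q \<partial>M) powr (1 / q))"
      unfolding X_def using S Lp[of c] hi
      by (intro mult_left_mono Holder_inequality[OF p q pq]) (auto simp: u_def)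
    finally have "\<bar>m - c\<bar> \<le> K * X powr (1 / p)" by (simp add: K_def mult.commute)
    \<comment> \<open>From here on p-th powers of norms are compared; the root is taken at the
      end.\<close>
    then have "\<bar>m - c\<bar> powr p \<le> (K * X powr (1 / p)) powr p"
      using p by (intro powr_mono2) auto
    also have "\<dots> = K powr p * X"
      using p \<open>X \<ge> 0\<close> by (simp add: powr_mult powr_powr)
    finally have mc: "\<bar>m - c\<bar> powr p \<le> K powr p * X" .
    \<comment> \<open>Split \<open>f - m\<close> into \<open>f - c\<close> and the constant
      \<open>c - m\<close>, whose size is controlled by \<open>mc\<close>.\<close>
    have "(\<integral>x. \<bar>(f x - m) * v x\<bar> powr p \<partial>M)
        \<le> (\<integral>x. 2 powr p * (\<bar>u x\<bar> powr p + \<bar>m - c\<bar> powr p * \<bar>v x\<bar> powr p) \<partial>M)"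
    proof (rule integral_mono)
      show "\<bar>(f x - m) * v x\<bar> powr p
          \<le> 2 powr p * (\<bar>u x\<bar> powr p + \<bar>m - c\<bar> powr p * \<bar>v x\<bar> powr p)" for x
      proof -
        have "(f x - m) * v x = u x + (c - m) * v x" by (simp add: u_def algebra_simps)
        then show ?thesis using abs_add_powr_le[of p "u x" "(c - m) * v x"] p
          by (simp add: abs_mult powr_mult abs_minus_commute)
      qed
    qed (use Lp[of c] Lp[of m] vi in \<open>auto simp: u_def\<close>)
    also have "\<dots> = 2 powr p * (X + \<bar>m - c\<bar> powr p * V)"
      using Lp[of c] vi by (simp add: X_def V_def u_def)
    also have "\<dots> \<le> 2 powr p * (X + (K powr p * X) * V)"
      using mc \<open>V \<ge> 0\<close> by (intro mult_left_mono add_left_mono mult_right_mono) auto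
    also have "\<dots> = C * X" by (simp add: C_def algebra_simps)
    finally have "(\<integral>x. \<bar>(f x - m) * v x\<bar> powr p \<partial>M) powr (1 / p) \<le> (C * X) powr (1 / p)"
      using p by (intro powr_mono2) auto
    then show ?thesis
      by (simp add: wLp_norm_def powr_mult X_def u_def m_def M_def)
  qed
  moreover have "C powr (1 / p) > 0" using \<open>C > 0\<close> by simp
  ultimately show ?thesis by blast
qed

text \<open>Makes \<open>weighted_mean_near_best\<close> applicable: the closure of a bounded set is
  compact, so a function continuous on it is bounded.\<close>

lemma C1_closure_measurable_bounded:
  assumes "f \<in> C1_closure E" and "open E" and "bounded E"
  shows "f \<in> borel_measurable (lebesgue_on E)" and "bounded (f ` E)"
proof -
  have cont: "continuous_on (closure E) f" using assms(1) by (simp add: C1_closure_def)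
  show "f \<in> borel_measurable (lebesgue_on E)"
    using continuous_on_subset[OF cont closure_subset] assms(2)
    by (intro continuous_imp_measurable_on_sets_lebesgue) auto
  have "compact (f ` closure E)"
    using cont assms(3) by (intro compact_continuous_image) auto
  then show "bounded (f ` E)"
    by (meson bounded_subset closure_subset compact_imp_bounded image_mono)
qed

theorem proposition1p9:
  fixes p :: real and E :: "(real ^ 'n) set" and v w :: "real ^ 'n \<Rightarrow> real"
  assumes "1 < p"
    and "open E" and "connected E" and "E \<noteq> {}" and "bounded E"
    and "weight_on E v"
    and "in_Lp p E v"
    and "(\<integral>x. v x \<partial>lebesgue_on E) > 0"
    and "w = (\<lambda>x. v x powr p)"
  shows "(\<exists>c1 > 0. \<exists>c2 > 0. \<exists>c3 > 0. \<forall>f \<in> C1_closure E.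
            c1 * wLp_norm p v E (\<lambda>x. f x - weighted_mean E w f)
              \<le> wLp_norm p v E (\<lambda>x. f x - weighted_mean E v f) \<and>
            wLp_norm p v E (\<lambda>x. f x - weighted_mean E v f)
              \<le> c2 * wLp_norm p v E (\<lambda>x. f x - weighted_mean E w f) \<and>
            wLp_norm p v E (\<lambda>x. f x - weighted_mean E v f)
              \<le> c3 * wLp_norm p v E (\<lambda>x. f x - mean E f)) \<and>
         (\<forall>p' :: real. 1 / p + 1 / p' = 1 \<and> inverse_in_Lp p' E v \<longrightarrow>
            (\<exists>c4 > 0. \<forall>f \<in> C1_closure E.
              wLp_norm p v E (\<lambda>x. f x - mean E f)
                \<le> c4 * wLp_norm p v E (\<lambda>x. f x - weighted_mean E v f)))"
proof -
  note p = \<open>1 < p\<close> and w = \<open>w = (\<lambda>x. v x powr p)\<close> and v = \<open>in_Lp p E v\<close>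
  define q where "q = p / (p - 1)"
  have q: "1 < q" "1 / p + 1 / q = 1"
    using p by (auto simp: q_def field_simps)
  have E: "E \<in> lmeasurable"
    using \<open>open E\<close> \<open>bounded E\<close> by (simp add: bounded_set_imp_lmeasurable)
  \<comment> \<open>HOL has \<open>ln (- x) = ln x\<close>, so this holds for negative bases too.\<close>
  have abs_powr: "\<bar>x\<bar> powr p = x powr p" for x :: real
    by (cases "x \<ge> 0") (simp_all add: powr_def ln_minus)
  have [measurable]: "v \<in> borel_measurable (lebesgue_on E)"
    and vi: "integrable (lebesgue_on E) (\<lambda>x. v x powr p)"
    using v by (auto simp: in_Lp_def abs_powr)
  have v0: "AE x in lebesgue_on E. 0 \<le> v x"
    using \<open>weight_on E v\<close> by (simp add: weight_on_def)
  \<comment> \<open>If the integral of \<open>v powr p\<close> were 0, then \<open>v\<close> would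
    vanish almost everywhere, against its positive integral.\<close>
  have wpos: "(\<integral>x. w x \<partial>lebesgue_on E) > 0"
  proof (rule ccontr)
    assume "\<not> ?thesis"
    moreover have "(\<integral>x. w x \<partial>lebesgue_on E) \<ge> 0"
      unfolding w by (rule integral_nonneg_AE) simp
    ultimately have "(\<integral>x. v x powr p \<partial>lebesgue_on E) = 0"
      unfolding w by linarith
    then have "AE x in lebesgue_on E. v x powr p = 0"
      using integral_nonneg_eq_0_iff_AE[OF vi] by simp
    then have "AE x in lebesgue_on E. v x = 0" by eventually_elim simp
    then have "(\<integral>x. v x \<partial>lebesgue_on E) = 0" by (rule integral_eq_zero_AE)
    with \<open>(\<integral>x. v x \<partial>lebesgue_on E) > 0\<close> show False by simp
  qed
  have measE: "measure lebesgue E > 0"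
    using open_not_negligible[OF \<open>open E\<close> \<open>E \<noteq> {}\<close>] E
    by (simp add: negligible_iff_measure0 zero_less_measure_iff)
  \<comment> \<open>The partner of \<open>v\<close> for the mean with weight \<open>v\<close>; it
    lies in the space because \<open>E\<close> has finite measure.\<close>
  have one: "in_Lp q E (\<lambda>x. 1)"
    using E by (simp add: in_Lp_def finite_measure.integrable_const[OF finite_measure_lebesgue_on])
  \<comment> \<open>The partner for the weight \<open>w\<close>: since
    \<open>(p - 1) * q = p\<close>, its q-th power is \<open>v powr p\<close>.\<close>
  have vpow: "in_Lp q E (\<lambda>x. v x powr (p - 1))"
    using p vi by (simp add: in_Lp_def powr_powr q_def)
  have "AE x in lebesgue_on E. w x = v x * v x powr (p - 1)"
    using v0 by eventually_elim (simp add: w powr_mult_base)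
  from weighted_mean_near_best[OF p q v vpow this wpos] obtain Cw where Cw: "Cw > 0"
    "\<And>f c. f \<in> borel_measurable (lebesgue_on E) \<Longrightarrow> bounded (f ` E) \<Longrightarrow>
      wLp_norm p v E (\<lambda>x. f x - weighted_mean E w f) \<le> Cw * wLp_norm p v E (\<lambda>x. f x - c)"
    by blast
  from weighted_mean_near_best[OF p q v one _ \<open>(\<integral>x. v x \<partial>lebesgue_on E) > 0\<close>]
  obtain Cv where Cv: "Cv > 0"
    "\<And>f c. f \<in> borel_measurable (lebesgue_on E) \<Longrightarrow> bounded (f ` E) \<Longrightarrow>
      wLp_norm p v E (\<lambda>x. f x - weighted_mean E v f) \<le> Cv * wLp_norm p v E (\<lambda>x. f x - c)"
    by auto
  note C1 = C1_closure_measurable_bounded[OF _ \<open>open E\<close> \<open>bounded E\<close>]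
  have "\<exists>c4 > 0. \<forall>f \<in> C1_closure E. wLp_norm p v E (\<lambda>x. f x - mean E f)
      \<le> c4 * wLp_norm p v E (\<lambda>x. f x - weighted_mean E v f)"
    if p': "1 / p + 1 / p' = 1" and inv: "inverse_in_Lp p' E v" for p'
  proof -
    \<comment> \<open>The conjugacy equation determines the exponent: reciprocals are injective in
      HOL, even with \<open>1 / 0 = 0\<close>.\<close>
    have "1 / p' = 1 / q" using q(2) p' by linarith
    then have "p' = q" by simp
    with inv have v_inv: "AE x in lebesgue_on E. v x \<noteq> 0" "in_Lp q E (\<lambda>x. inverse (v x))"
      by (auto simp: inverse_in_Lp_def)
    \<comment> \<open>The plain mean has weight 1 and partner \<open>inverse (v x)\<close>. As
      \<open>inverse 0 = 0\<close>, the factorisation fails at zeros of \<open>v\<close>, which form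
      a null set by \<open>inverse_in_Lp\<close>.\<close>
    have "AE x in lebesgue_on E. 1 = v x * inverse (v x)"
      using v_inv(1) by eventually_elim simp
    moreover have total: "(\<integral>x. 1 \<partial>lebesgue_on E) = measure lebesgue E"
      using E by (simp add: measure_restrict_space)
    ultimately obtain C where "C > 0"
      "\<And>f c. f \<in> borel_measurable (lebesgue_on E) \<Longrightarrow> bounded (f ` E) \<Longrightarrow>
        wLp_norm p v E (\<lambda>x. f x - weighted_mean E (\<lambda>x. 1) f) \<le> C * wLp_norm p v E (\<lambda>x. f x - c)"
      using weighted_mean_near_best[OF p q v v_inv(2), of "\<lambda>x. 1"] measE by auto
    moreover have "weighted_mean E (\<lambda>x. 1) f = mean E f" for f
      unfolding weighted_mean_def mean_def total by simp
    ultimately show ?thesis using C1 by (intro exI[of _ C]) auto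
  qed
  \<comment> \<open>Here \<open>c\<close> is the mean with weight \<open>v\<close>, and
    \<open>c1\<close> is \<open>1 / Cw\<close>.\<close>
  moreover have "1 / Cw * wLp_norm p v E (\<lambda>x. f x - weighted_mean E w f)
      \<le> wLp_norm p v E (\<lambda>x. f x - weighted_mean E v f)" if "f \<in> C1_closure E" for f
    using Cw(2)[OF C1[OF that], of "weighted_mean E v f"] Cw(1)
    by (simp add: pos_divide_le_eq mult.commute)
  moreover have "1 / Cw > 0" using Cw(1) by simp
  \<comment> \<open>\<open>Cv\<close> serves both as \<open>c2\<close> and as \<open>c3\<close>,
    with \<open>c\<close> the mean with weight \<open>w\<close> and the plain mean
    respectively.\<close>
  moreover note Cv(1) Cv(2)[OF C1]
  ultimately show ?thesis by (intro conjI) blast+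
qed

end
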